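(* Let $\mathcal{I}$ be an invariant ideal on $\mathbf{N}$, let $x=(x_n)_{n\in\mathbf{N}}$ be a sequence taking values in a topological space $X$, and let $\ell\in X$. Then $x\to_{\mathcal{I}}\ell$ if and only if $$ \lambda\left(\left\{\omega\in(0,1]: x\upharpoonright\omega\to_{\mathcal{I}}\ell\right\}\right)=1. $$
   Context: $\mathbf{N}$ denotes the set of positive integers. An ideal $\mathcal{I}$ on $\mathbf{N}$ is a family of subsets of $\mathbf{N}$ closed under finite unions and under taking subsets of its elements; it is always assumed that $\mathcal{I}$ contains all finite subsets of $\mathbf{N}$ and that $\mathcal{I}$ is different from the whole power set of $\mathbf{N}$. For infinite sets $A,B\subseteq\mathbf{N}$, with $\{a_n:n\in\mathbf{N}\}$ the canonical (increasing) enumeration of $A$, define $A_B:=\{a_b:b\in B\}$. A set $A\subseteq\mathbf{N}$ has positive asymptotic density if the limit $\lim_{n\to\infty}|A\cap[1,n]|/n$ exists and is positive. An ideal $\mathcal{I}$ is invariant if, for each $A\subseteq\mathbf{N}$ with positive asymptotic density and each infinite $B\subseteq\mathbf{N}$, one has $A_B\notin\mathcal{I}$ if and only if $B\notin\mathcal{I}$. A sequence $x=(x_n)$ in a topological space $X$ converges with respect to $\mathcal{I}$ to $\ell\in X$, written $x\to_{\mathcal{I}}\ell$, if $\{n\in\mathbf{N}:x_n\notin U\}\in\mathcal{I}$ for every neighborhood $U$ of $\ell$. Each $\omega\in(0,1]$ has a unique non-terminating dyadic expansion $\omega=\sum_{i\ge1}d_i(\omega)2^{-i}$ with $d_i(\omega)\in\{0,1\}$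 and $d_i(\omega)=1$ for infinitely many $i$. The sequence $x\upharpoonright\omega$ is the subsequence of $(x_n)$ obtained by omitting $x_i$ if and only if $d_i(\omega)=0$ (reindexed by $\mathbf{N}$ in increasing order of the remaining indices). $\lambda$ denotes the Lebesgue measure on the completion of the Borel $\sigma$-algebra of $(0,1]$; the statement that $\lambda$ of a set equals $1$ includes that the set is measurable with respect to this completed $\sigma$-algebra. *)

theory Defs
  imports "HOL-Analysis.Analysis"
begin

text \<open>
  The positive integers are rendered as the set \<open>{1..}\<close> of type \<open>nat set\<close>; sequences indexed by
  positive integers are functions on \<open>nat\<close> whose value at \<open>0\<close> is never used.
\<close>

definition ideal_on_pos :: "nat set set \<Rightarrow> bool" where
  "ideal_on_pos I \<longleftrightarrow>
     I \<subseteq> Pow {1..} \<and>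
     (\<forall>A\<in>I. \<forall>B\<in>I. A \<union> B \<in> I) \<and>
     (\<forall>A\<in>I. \<forall>B. B \<subseteq> A \<longrightarrow> B \<in> I) \<and>
     (\<forall>A. A \<subseteq> {1..} \<and> finite A \<longrightarrow> A \<in> I) \<and>
     I \<noteq> Pow {1..}"

text \<open>
  Canonical enumeration \<open>a\<^sub>1 < a\<^sub>2 < \<dots>\<close> of an infinite set; the library's
  \<^const>\<open>enumerate\<close> starts at index \<open>0\<close>.
\<close>

definition pos_enum :: "nat set \<Rightarrow> nat \<Rightarrow> nat" where
  "pos_enum A n = enumerate A (n - 1)"

definition subset_along :: "nat set \<Rightarrow> nat set \<Rightarrow> nat set" where
  "subset_along A B = {pos_enum A b | b. b \<in> B}"

definition positive_density :: "nat set \<Rightarrow> bool" where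
  "positive_density A \<longleftrightarrow>
     (\<exists>d>0. (\<lambda>n. real (card (A \<inter> {1..n})) / real n) \<longlonglongrightarrow> d)"

definition invariant_ideal :: "nat set set \<Rightarrow> bool" where
  "invariant_ideal I \<longleftrightarrow>
     ideal_on_pos I \<and>
     (\<forall>A B. A \<subseteq> {1..} \<and> positive_density A \<and> B \<subseteq> {1..} \<and> infinite B \<longrightarrow>
        (subset_along A B \<notin> I \<longleftrightarrow> B \<notin> I))"

definition ideal_converges ::
  "'a topology \<Rightarrow> nat set set \<Rightarrow> (nat \<Rightarrow> 'a) \<Rightarrow> 'a \<Rightarrow> bool" where
  "ideal_converges X I x l \<longleftrightarrow>
     (\<forall>U. U \<subseteq> topspace X \<and> (\<exists>V. openin X V \<and> l \<in> V \<and> V \<subseteq> U) \<longrightarrow>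
        {n \<in> {1..}. x n \<notin> U} \<in> I)"

text \<open>
  The requirement \<open>d 0 = 0\<close> pins down the unused index, so that the series below is the sum over
  \<open>i \<ge> 1\<close> and the expansion is unique as a function on \<open>nat\<close>.
\<close>

definition nonterminating_dyadic :: "(nat \<Rightarrow> nat) \<Rightarrow> real \<Rightarrow> bool" where
  "nonterminating_dyadic d \<omega> \<longleftrightarrow>
     d 0 = 0 \<and> (\<forall>i. d i \<in> {0, 1}) \<and> infinite {i. d i = 1} \<and>
     (\<lambda>i. real (d i) / 2 ^ i) sums \<omega>"

definition dyadic_digit :: "real \<Rightarrow> nat \<Rightarrow> nat" where
  "dyadic_digit \<omega> = (THE d. nonterminating_dyadic d \<omega>)"

definition subseq_at :: "(nat \<Rightarrow> 'a) \<Rightarrow> real \<Rightarrow> nat \<Rightarrow> 'a" where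
  "subseq_at x \<omega> n = x (pos_enum {i \<in> {1..}. dyadic_digit \<omega> i \<noteq> 0} n)"

lemma nonterminating_dyadic_shift:
  assumes "nonterminating_dyadic d w"
  shows "nonterminating_dyadic (\<lambda>i. if i = 0 then 0 else d (Suc i)) (2 * w - real (d 1))"
proof -
  let ?e = "\<lambda>i. if i = 0 then 0 else d (Suc i)"
  have d: "d 0 = 0" "\<And>i. d i \<in> {0, 1}" "infinite {i. d i = 1}" "(\<lambda>i. real (d i) / 2 ^ i) sums w"
    using assms by (auto simp: nonterminating_dyadic_def)
  have "(\<lambda>i. real (d (Suc i)) / 2 ^ Suc i) sums w"
    using d(1) d(4) by (subst sums_Suc_iff) simp
  then have "(\<lambda>i. 2 * (real (d (Suc i)) / 2 ^ Suc i)) sums (2 * w)"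
    by (rule sums_mult)
  then have "(\<lambda>i. real (d (Suc i)) / 2 ^ i) sums (2 * w)"
    by simp
  then have "(\<lambda>i. real (d (Suc (Suc i))) / 2 ^ Suc i) sums (2 * w - real (d 1))"
    by (subst sums_Suc_iff) simp
  then have "(\<lambda>i. real (?e (Suc i)) / 2 ^ Suc i) sums (2 * w - real (d 1))"
    by simp
  then have s: "(\<lambda>i. real (?e i) / 2 ^ i) sums (2 * w - real (d 1))"
    by (subst (asm) sums_Suc_iff) simp
  have "{i. d i = 1} \<subseteq> {0, 1} \<union> Suc ` {i. ?e i = 1}"
  proof
    fix i assume "i \<in> {i. d i = 1}"
    then show "i \<in> {0, 1} \<union> Suc ` {i. ?e i = 1}"
      by (cases i) (auto simp: image_iff)
  qed
  then have "infinite {i. ?e i = 1}"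
    using d(3) by (meson finite.emptyI finite.insertI finite_UnI finite_imageI finite_subset)
  with s d(2) show ?thesis by (simp add: nonterminating_dyadic_def)
qed

lemma nonterminating_dyadic_bounds:
  assumes "nonterminating_dyadic d w"
  shows "0 < w" "w \<le> 1"
proof -
  have d: "d 0 = 0" "\<And>i. d i \<in> {0, 1}" "infinite {i. d i = 1}" "(\<lambda>i. real (d i) / 2 ^ i) sums w"
    using assms by (auto simp: nonterminating_dyadic_def)
  obtain k where k: "d k = 1" using d(3) by (metis (mono_tags) finite.emptyI mem_Collect_eq equals0I)
  have "0 < (\<Sum>i. real (d i) / 2 ^ i)"
    by (rule suminf_pos2[where i = k]) (use d(4) k in \<open>auto simp: sums_iff\<close>)
  then show "0 < w" using d(4) by (simp add: sums_iff)
  have "(\<lambda>i. real (d (Suc i)) / 2 ^ Suc i) sums w"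
    using d(1) d(4) by (subst sums_Suc_iff) simp
  moreover have "(\<lambda>i. (1/2) ^ Suc i :: real) sums 1" by (rule power_half_series)
  ultimately show "w \<le> 1"
  proof (rule sums_le[rotated])
    fix i show "real (d (Suc i)) / 2 ^ Suc i \<le> (1/2) ^ Suc i"
      using d(2)[of "Suc i"] by (auto simp: power_one_over divide_simps)
  qed
qed

lemma nonterminating_dyadic_agree:
  assumes "nonterminating_dyadic d w" "nonterminating_dyadic e w"
  shows "d n = e n"
  using assms
proof (induction n arbitrary: d e w)
  case 0
  then show ?case by (simp add: nonterminating_dyadic_def)
next
  case (Suc n)
  note sd = nonterminating_dyadic_shift[OF Suc.prems(1)]
  note se = nonterminating_dyadic_shift[OF Suc.prems(2)]
  have "d 1 \<in> {0, 1}" "e 1 \<in> {0, 1}"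
    using Suc.prems by (auto simp: nonterminating_dyadic_def)
  with nonterminating_dyadic_bounds[OF sd] nonterminating_dyadic_bounds[OF se]
  have eq: "d 1 = e 1" by auto
  show ?case
  proof (cases "n = 0")
    case False
    with Suc.IH[OF sd] se eq show ?thesis by simp
  qed (use eq in simp)
qed

lemma nonterminating_dyadic_ex1:
  assumes "\<omega> \<in> {0<..1}"
  shows "\<exists>!d. nonterminating_dyadic d \<omega>"
proof (rule ex_ex1I)
  define c :: "nat \<Rightarrow> int" where "c n = \<lceil>2 ^ n * \<omega>\<rceil> - 1" for n
  have c1: "real_of_int (c n) < 2 ^ n * \<omega>" and c2: "2 ^ n * \<omega> \<le> real_of_int (c n) + 1" for n
    unfolding c_def by linarith+
  have c0: "c 0 = 0" using assms unfolding c_def by (simp add: ceiling_eq_iff)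
  define d where "d i = (case i of 0 \<Rightarrow> 0 | Suc n \<Rightarrow> nat (c (Suc n) - 2 * c n))" for i
  have step: "c (Suc n) - 2 * c n \<in> {0, 1}" for n
  proof -
    have "real_of_int (c (Suc n) - 2 * c n) < 2" "real_of_int (c (Suc n) - 2 * c n) > -1"
      using c1[of n] c2[of n] c1[of "Suc n"] c2[of "Suc n"] by (simp_all add: algebra_simps)
    then have "c (Suc n) - 2 * c n < 2" "c (Suc n) - 2 * c n > -1"
      by linarith+
    then show ?thesis by auto
  qed
  have dS: "real (d (Suc n)) = real_of_int (c (Suc n)) - 2 * real_of_int (c n)" for n
    using step[of n] by (auto simp: d_def)
  have ps: "(\<Sum>i<Suc n. real (d i) / 2 ^ i) = real_of_int (c n) / 2 ^ n" for n
  proof (induction n)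
    case 0 then show ?case by (simp add: d_def c0)
  next
    case (Suc n) then show ?case
      by (simp only: sum.lessThan_Suc[of _ "Suc n"] dS) (simp add: field_simps)
  qed
  have "(\<lambda>n. real_of_int (c n) / 2 ^ n) \<longlonglongrightarrow> \<omega>"
  proof (rule real_tendsto_sandwich)
    show "\<forall>\<^sub>F n in sequentially. \<omega> - (1/2) ^ n \<le> real_of_int (c n) / 2 ^ n"
    proof (intro always_eventually allI)
      fix n
      have "\<omega> - (1/2) ^ n = (2 ^ n * \<omega> - 1) / 2 ^ n"
        by (simp add: diff_divide_distrib power_one_over)
      also have "\<dots> \<le> real_of_int (c n) / 2 ^ n"
        using c2[of n] by (intro divide_right_mono) simp_all
      finally show "\<omega> - (1/2) ^ n \<le> real_of_int (c n) / 2 ^ n" .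
    qed
    show "\<forall>\<^sub>F n in sequentially. real_of_int (c n) / 2 ^ n \<le> \<omega>"
      using less_imp_le[OF c1] by (intro always_eventually allI) (simp add: field_simps)
    have "(\<lambda>n. \<omega> - (1/2) ^ n) \<longlonglongrightarrow> \<omega> - 0"
      by (intro tendsto_diff tendsto_const LIMSEQ_power_zero) simp
    then show "(\<lambda>n. \<omega> - (1/2) ^ n) \<longlonglongrightarrow> \<omega>" by simp
  qed simp
  then have sums: "(\<lambda>i. real (d i) / 2 ^ i) sums \<omega>"
    unfolding sums_def by (subst filterlim_sequentially_Suc[symmetric]) (simp only: ps)
  have d01: "d i \<in> {0, 1}" for i
  proof (cases i)
    case (Suc n)
    then show ?thesis using step[of n] by (auto simp: d_def)
  qed (simp add: d_def)
  have "infinite {i. d i = 1}"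
  proof
    assume "finite {i. d i = 1}"
    then obtain m where m: "\<And>i. d i = 1 \<Longrightarrow> i \<le> m"
      by (auto simp: finite_nat_set_iff_bounded_le)
    have z: "real (d i) / 2 ^ i = 0" if "i \<notin> {..<Suc m}" for i
      using m[of i] d01[of i] that by auto
    have "(\<lambda>i. real (d i) / 2 ^ i) sums (\<Sum>i<Suc m. real (d i) / 2 ^ i)"
      by (rule sums_finite) (use z in auto)
    then have "\<omega> = real_of_int (c m) / 2 ^ m"
      using sums sums_unique2 ps by metis
    then show False using c1[of m] by simp
  qed
  then show "\<exists>d. nonterminating_dyadic d \<omega>"
    using sums d01 unfolding nonterminating_dyadic_def
    by (intro exI[of _ d]) (auto simp: d_def)
qed (use nonterminating_dyadic_agree in blast)

end

theory Submission
  imports Defs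
begin

text \<open>
  Write \<open>A(w)\<close> for the set of indices at which the dyadic expansion of \<open>w\<close> has the digit \<open>1\<close>, so
  that \<open>x\<close> restricted to \<open>w\<close> is the subsequence of \<open>x\<close> along \<open>A(w)\<close>.  For almost every \<open>w\<close> the set
  \<open>A(w)\<close> has asymptotic density \<open>1/2\<close> (Borel's normal number theorem,
  \<open>negligible_non_balanced_digits\<close>).  For such \<open>w\<close> the invariance of the ideal removes the
  reindexing: the subsequence converges to \<open>l\<close> if and only if
  \<open>A(w) \<inter> {n. x n \<notin> U}\<close> belongs to the ideal for every neighbourhood \<open>U\<close> of \<open>l\<close>
  (\<open>ideal_converges_subsequence_iff\<close>).

  If \<open>x\<close> itself converges, these sets are subsets of members of the ideal, so all subsequences with
  balanced digits converge, and the exceptional \<open>w\<close> form a null set.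

  Conversely, suppose that almost all subsequences converge.  The reflection \<open>w \<mapsto> 1 - w\<close> preserves
  null sets and, apart from dyadic rationals, exchanges the digits \<open>0\<close> and \<open>1\<close>.  Hence some \<open>w\<close> is
  such that \<open>w\<close> and \<open>1 - w\<close> both have balanced digits and both give convergent subsequences.  As \<open>A(w)\<close>
  and \<open>A(1 - w)\<close> partition the positive integers, \<open>{n. x n \<notin> U}\<close> is a union of two members of the
  ideal.  The same \<open>w\<close> serves all neighbourhoods \<open>U\<close> at once.
  Measurability of the set of good \<open>w\<close> comes from the completeness of Lebesgue measure:
  once its complement is contained in a null set, the set is measurable.
\<close>

section \<open>Invariant ideals along sets of positive density\<close>

lemma positive_density_imp_infinite:
  assumes "positive_density A"
  shows "infinite A"
proof
  assume fin: "finite A"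
  obtain d where "d > 0" and d: "(\<lambda>n. real (card (A \<inter> {1..n})) / real n) \<longlonglongrightarrow> d"
    using assms by (auto simp: positive_density_def)
  have "(\<lambda>n. real (card (A \<inter> {1..n})) / real n) \<longlonglongrightarrow> 0"
  proof (rule real_tendsto_sandwich[where f = "\<lambda>_. 0"])
    show "\<forall>\<^sub>F n in sequentially. real (card (A \<inter> {1..n})) / real n \<le> real (card A) / real n"
      by (intro always_eventually allI divide_right_mono) (auto intro: card_mono fin)
    show "(\<lambda>n. real (card A) / real n) \<longlonglongrightarrow> 0"
      by (rule lim_const_over_n)
  qed simp_all
  with d \<open>d > 0\<close> show False
    using LIMSEQ_unique by fastforce
qed

text \<open>
  The set \<open>{n. a\<^sub>n \<in> E}\<close> is the index set that \<^const>\<open>subset_along\<close> carries to \<open>A \<inter> E\<close>; this is how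
  the exceptional set of a subsequence is matched with that of the whole sequence.
\<close>

lemma subset_along_preimage:
  assumes "infinite A"
  shows "subset_along A {n \<in> {1..}. pos_enum A n \<in> E} = A \<inter> E"
proof -
  have "\<exists>n\<ge>1. pos_enum A n = a" if "a \<in> A" for a
  proof -
    obtain m where "enumerate A m = a"
      using enumerate_Ex[OF assms \<open>a \<in> A\<close>] by blast
    then show ?thesis
      by (intro exI[of _ "Suc m"]) (simp add: pos_enum_def)
  qed
  moreover have "pos_enum A n \<in> A" for n
    using assms by (simp add: pos_enum_def enumerate_in_set)
  ultimately show ?thesis
    unfolding subset_along_def by (auto; metis)
qed

text \<open>
  Invariance speaks of infinite index sets only.  When the index set is finite, so is its image
  \<open>A \<inter> E\<close>, and both lie in the ideal.
\<close>

lemma invariant_ideal_preimage_iff: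
  assumes I: "invariant_ideal I" and A: "A \<subseteq> {1..}" "positive_density A"
  shows "{n \<in> {1..}. pos_enum A n \<in> E} \<in> I \<longleftrightarrow> A \<inter> E \<in> I"
proof -
  let ?B = "{n \<in> {1..}. pos_enum A n \<in> E}"
  have along: "subset_along A ?B = A \<inter> E"
    using subset_along_preimage positive_density_imp_infinite A(2) by blast
  show ?thesis
  proof (cases "finite ?B")
    case True
    have "A \<inter> E = pos_enum A ` ?B"
      unfolding along[symmetric] subset_along_def by blast
    then have "finite (A \<inter> E)"
      using True by simp
    moreover have fin: "F \<in> I" if "F \<subseteq> {1..}" "finite F" for F
      using I that by (simp add: invariant_ideal_def ideal_on_pos_def)
    ultimately show ?thesis
      using True A(1) by (intro iffI fin) auto
  next
    case False
    have "?B \<subseteq> {1..}" by blast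
    then have "subset_along A ?B \<notin> I \<longleftrightarrow> ?B \<notin> I"
      using I A False unfolding invariant_ideal_def by blast
    then show ?thesis
      unfolding along by blast
  qed
qed

lemma ideal_converges_subsequence_iff:
  assumes I: "invariant_ideal I" and A: "A \<subseteq> {1..}" "positive_density A"
  shows "ideal_converges X I (\<lambda>n. x (pos_enum A n)) l \<longleftrightarrow>
    (\<forall>U. U \<subseteq> topspace X \<and> (\<exists>V. openin X V \<and> l \<in> V \<and> V \<subseteq> U) \<longrightarrow> {n \<in> A. x n \<notin> U} \<in> I)"
proof -
  have "{n \<in> {1..}. x (pos_enum A n) \<notin> U} \<in> I \<longleftrightarrow> {n \<in> A. x n \<notin> U} \<in> I" for U
    using invariant_ideal_preimage_iff[OF assms, of "{n. x n \<notin> U}"]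
    by (simp add: Int_def)
  then show ?thesis
    unfolding ideal_converges_def by presburger
qed

section \<open>Almost every dyadic expansion has digits of density one half\<close>

abbreviation digit_set :: "real \<Rightarrow> nat set" where
  "digit_set w \<equiv> {i \<in> {1..}. dyadic_digit w i \<noteq> 0}"

lemma nonterminating_dyadic_digit:
  assumes "w \<in> {0<..1}"
  shows "nonterminating_dyadic (dyadic_digit w) w"
  unfolding dyadic_digit_def by (rule theI'[OF nonterminating_dyadic_ex1[OF assms]])

lemma dyadic_digit_unique:
  assumes "nonterminating_dyadic d w"
  shows "dyadic_digit w = d"
  using nonterminating_dyadic_agree[OF nonterminating_dyadic_digit assms]
    nonterminating_dyadic_bounds[OF assms] by (intro ext) auto

text \<open>
  The doubling map, in the version on \<open>(0, 1]\<close> that belongs to non-terminating expansions: it deletes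
  the first digit.
\<close>

definition dyadic_shift :: "real \<Rightarrow> real" where
  "dyadic_shift w = (if w \<le> 1/2 then 2 * w else 2 * w - 1)"

lemma dyadic_shift_mem: "w \<in> {0<..1} \<Longrightarrow> dyadic_shift w \<in> {0<..1}"
  by (auto simp: dyadic_shift_def)

lemma dyadic_digit_1:
  assumes "w \<in> {0<..1}"
  shows "dyadic_digit w 1 = (if w \<le> 1/2 then 0 else 1)"
proof -
  have nd: "nonterminating_dyadic (dyadic_digit w) w"
    using assms by (rule nonterminating_dyadic_digit)
  then have "dyadic_digit w 1 \<in> {0, 1}"
    by (simp add: nonterminating_dyadic_def)
  with nonterminating_dyadic_bounds[OF nonterminating_dyadic_shift[OF nd]] show ?thesis
    by auto
qed

lemma dyadic_digit_shift:
  assumes "w \<in> {0<..1}"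
  shows "dyadic_digit w (Suc (Suc i)) = dyadic_digit (dyadic_shift w) (Suc i)"
proof -
  have "2 * w - real (dyadic_digit w 1) = dyadic_shift w"
    by (simp only: dyadic_digit_1[OF assms] dyadic_shift_def) auto
  then show ?thesis
    using dyadic_digit_unique
      [OF nonterminating_dyadic_shift[OF nonterminating_dyadic_digit[OF assms]]]
    by simp
qed

text \<open>
  The simple random walk that steps up at a digit \<open>1\<close> and down at a digit \<open>0\<close>.  Defining it through the
  doubling map, rather than through the digits, makes its measurability immediate and reduces
  integrals over \<open>n + 1\<close> digits to integrals over \<open>n\<close> digits.
\<close>

primrec digit_walk :: "nat \<Rightarrow> real \<Rightarrow> real" where
  "digit_walk 0 w = 0"
| "digit_walk (Suc n) w = (if w \<le> 1/2 then -1 else 1) + digit_walk n (dyadic_shift w)"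

lemma measurable_dyadic_shift [measurable]: "dyadic_shift \<in> borel_measurable borel"
  unfolding dyadic_shift_def by measurable

lemma measurable_digit_walk [measurable]: "digit_walk n \<in> borel_measurable borel"
proof (induction n)
  case (Suc n)
  note [measurable] = Suc
  show ?case by simp
qed simp

lemma digit_walk_eq_sum:
  assumes "w \<in> {0<..1}"
  shows "digit_walk n w = (\<Sum>i<n. 2 * real (dyadic_digit w (Suc i)) - 1)"
  using assms
proof (induction n arbitrary: w)
  case (Suc n)
  show ?case
    using Suc.IH[OF dyadic_shift_mem[OF Suc.prems]] dyadic_digit_1[OF Suc.prems]
    by (simp add: sum.lessThan_Suc_shift dyadic_digit_shift[OF Suc.prems] del: sum.lessThan_Suc)
qed simp

lemma digit_walk_eq_card:
  assumes "w \<in> {0<..1}"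
  shows "digit_walk n w = 2 * real (card (digit_set w \<inter> {1..n})) - real n"
proof -
  have d01: "dyadic_digit w i \<in> {0, 1}" for i
    using nonterminating_dyadic_digit[OF assms] by (simp add: nonterminating_dyadic_def)
  have "(\<Sum>i<n. dyadic_digit w (Suc i)) = (\<Sum>i\<in>{1..n}. dyadic_digit w i)"
    by (simp add: sum.atLeast1_atMost_eq)
  also have "\<dots> = (\<Sum>i\<in>{1..n}. if dyadic_digit w i \<noteq> 0 then 1 else 0)"
  proof (intro sum.cong refl)
    fix i
    show "dyadic_digit w i = (if dyadic_digit w i \<noteq> 0 then 1 else 0)"
      using d01[of i] by auto
  qed
  also have "\<dots> = card {i \<in> {1..n}. dyadic_digit w i \<noteq> 0}"
    by (simp add: sum.If_cases Int_def)
  also have "{i \<in> {1..n}. dyadic_digit w i \<noteq> 0} = digit_set w \<inter> {1..n}"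
    by auto
  finally have *: "(\<Sum>i<n. dyadic_digit w (Suc i)) = card (digit_set w \<inter> {1..n})" .
  show ?thesis
    unfolding digit_walk_eq_sum[OF assms] *[symmetric]
    by (simp add: sum_subtractf sum_distrib_left)
qed

text \<open>
  The moment generating function of the walk.  Independence of the digits enters as self-similarity:
  the two halves of \<open>(0, 1]\<close> are each mapped affinely onto \<open>(0, 1]\<close> by the doubling map, and on
  each half the first step is constant, so one more step contributes the factor
  \<open>(exp (- t) + exp t) / 2 = cosh t\<close>.
\<close>

lemma nn_integral_exp_digit_walk:
  "(\<integral>\<^sup>+w. ennreal (exp (t * digit_walk n w)) * indicator {0<..1} w \<partial>lborel) = ennreal (cosh t ^ n)"
proof (induction n)
  case 0
  then show ?case by simp
next
  case (Suc n)
  define g :: "real \<Rightarrow> ennreal"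
    where "g w = ennreal (exp (t * digit_walk n w)) * indicator {0<..1} w" for w
  have [measurable]: "g \<in> borel_measurable borel"
    unfolding g_def by measurable
  define h where "h = cosh t ^ n / 2"
  have h: "h \<ge> 0" by (simp add: h_def)
  \<comment> \<open>The offsets that occur are \<open>a = 0\<close> on the left half and \<open>a = - 1\<close> on the right half.\<close>
  have half: "(\<integral>\<^sup>+w. g (a + 2 * w) \<partial>lborel) = ennreal h" for a
  proof -
    have "ennreal (cosh t ^ n) = ennreal 2 * (\<integral>\<^sup>+w. g (a + 2 * w) \<partial>lborel)"
      using nn_integral_real_affine[of g 2 a] Suc unfolding g_def by simp
    then have "ennreal (1/2) * ennreal (cosh t ^ n)
        = (ennreal (1/2) * ennreal 2) * (\<integral>\<^sup>+w. g (a + 2 * w) \<partial>lborel)"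
      by (simp only: mult.assoc)
    also have "ennreal (1/2) * ennreal 2 = 1"
      by (subst ennreal_mult[symmetric]) auto
    also have "ennreal (1/2) * ennreal (cosh t ^ n) = ennreal h"
      by (subst ennreal_mult[symmetric]) (auto simp: h_def)
    finally show ?thesis by simp
  qed
  have "ennreal (exp (t * digit_walk (Suc n) w)) * indicator {0<..1} w
      = ennreal (exp (- t)) * g (0 + 2 * w) + ennreal (exp t) * g (- 1 + 2 * w)" for w
  proof -
    have "exp (t * (c + v)) = exp (t * c) * exp (t * v)" for c v :: real
      by (simp add: ring_distribs exp_add)
    then show ?thesis
      by (auto simp: g_def dyadic_shift_def ennreal_mult' mult.assoc split: split_indicator)
  qed
  then have "(\<integral>\<^sup>+w. ennreal (exp (t * digit_walk (Suc n) w)) * indicator {0<..1} w \<partial>lborel)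
      = (\<integral>\<^sup>+w. ennreal (exp (- t)) * g (0 + 2 * w) + ennreal (exp t) * g (- 1 + 2 * w) \<partial>lborel)"
    by presburger
  also have "\<dots> = ennreal (exp (- t)) * ennreal h + ennreal (exp t) * ennreal h"
    by (subst nn_integral_add, simp, simp, subst (1 2) nn_integral_cmult, simp, simp) (simp only: half)
  also have "\<dots> = ennreal (exp (- t) * h + exp t * h)"
    using h by (simp add: ennreal_mult')
  also have "exp (- t) * h + exp t * h = cosh t ^ Suc n"
    by (simp add: cosh_field_def h_def field_simps)
  finally show ?case .
qed

text \<open>
  The exponent is quadratic in \<open>t\<close>, which lets the penalty \<open>exp (- 2 * t\<^sup>2)\<close> per step below win
  against the growth \<open>cosh t\<close> per step.
\<close>

lemma cosh_le_exp_square: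
  fixes t :: real
  assumes "\<bar>t\<bar> \<le> 1"
  shows "cosh t \<le> exp (t\<^sup>2)"
proof -
  define s where "s = \<bar>t\<bar>"
  have s: "0 \<le> s" "s \<le> 1" using assms by (auto simp: s_def)
  have "exp s \<le> 1 + s + s\<^sup>2"
    using exp_bound s by blast
  moreover have "exp (- s) \<le> 1 - s + s\<^sup>2"
  proof -
    have "1 \<le> 1 + (s\<^sup>2 + s ^ 3 + s ^ 4) / 2" using s by simp
    also have "\<dots> = (1 - s + s\<^sup>2) * (1 + s + s\<^sup>2 / 2)"
      by (simp add: power2_eq_square power3_eq_cube power4_eq_xxxx field_simps)
    also have "\<dots> \<le> (1 - s + s\<^sup>2) * exp s"
      using s exp_lower_Taylor_quadratic[of s] by (intro mult_left_mono) auto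
    finally show ?thesis by (simp add: exp_minus field_simps)
  qed
  ultimately have "cosh s \<le> 1 + s\<^sup>2"
    by (simp add: cosh_field_def)
  also have "\<dots> \<le> exp (s\<^sup>2)" by (rule exp_ge_add_one_self)
  finally show ?thesis by (simp add: s_def cosh_real_abs)
qed

text \<open>
  A Chernoff bound and the Borel-Cantelli argument in one step: the integrals of
  \<open>exp (t * digit_walk n w - 2 * t\<^sup>2 * n)\<close> form a convergent geometric series, so for almost every \<open>w\<close>
  these quantities are summable over \<open>n\<close> and in particular eventually less than \<open>1\<close>.  The sign of \<open>t\<close>
  is free, so that both tails of the walk are covered.
\<close>

lemma AE_digit_walk_eventually_less:
  assumes "t \<noteq> 0" "\<bar>t\<bar> \<le> 1"
  shows "AE w in lborel. w \<in> {0<..1} \<longrightarrow> (\<forall>\<^sub>F n in sequentially. t * digit_walk n w < 2 * t\<^sup>2 * real n)"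
proof -
  define q where "q = exp (- 2 * t\<^sup>2) * cosh t"
  have q: "0 \<le> q" "q < 1"
  proof -
    have "q \<le> exp (- 2 * t\<^sup>2) * exp (t\<^sup>2)"
      unfolding q_def by (intro mult_left_mono cosh_le_exp_square assms) simp
    also have "\<dots> = exp (- t\<^sup>2)" by (simp flip: exp_add)
    also have "\<dots> < 1" using assms by simp
    finally show "q < 1" .
  qed (simp add: q_def)
  define f where "f n w = exp (t * digit_walk n w - 2 * t\<^sup>2 * real n)" for n w
  have [measurable]: "f n \<in> borel_measurable borel" for n
    unfolding f_def by measurable
  have int: "(\<integral>\<^sup>+w. ennreal (f n w) * indicator {0<..1} w \<partial>lborel) = ennreal (q ^ n)" for n
  proof -
    have "f n w = exp (- 2 * t\<^sup>2) ^ n * exp (t * digit_walk n w)" for w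
      by (simp add: f_def exp_of_nat_mult[symmetric] exp_add[symmetric] algebra_simps)
    then have "(\<integral>\<^sup>+w. ennreal (f n w) * indicator {0<..1} w \<partial>lborel)
       = (\<integral>\<^sup>+w. ennreal (exp (- 2 * t\<^sup>2) ^ n) *
            (ennreal (exp (t * digit_walk n w)) * indicator {0<..1} w) \<partial>lborel)"
      by (simp add: ennreal_mult' mult.assoc)
    also have "\<dots> = ennreal (exp (- 2 * t\<^sup>2) ^ n) * ennreal (cosh t ^ n)"
      by (subst nn_integral_cmult, simp) (simp only: nn_integral_exp_digit_walk)
    also have "\<dots> = ennreal (q ^ n)"
      by (simp add: q_def power_mult_distrib ennreal_mult')
    finally show ?thesis .
  qed
  have "(\<integral>\<^sup>+w. (\<Sum>n. ennreal (f n w) * indicator {0<..1} w) \<partial>lborel) = (\<Sum>n. ennreal (q ^ n))"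
    by (subst nn_integral_suminf) (simp_all add: int)
  also have "\<dots> \<noteq> \<infinity>"
    using q by (subst suminf_ennreal2) (auto intro: summable_geometric)
  finally have "AE w in lborel. (\<Sum>n. ennreal (f n w) * indicator {0<..1} w) \<noteq> \<infinity>"
    by (intro nn_integral_PInf_AE) auto
  then show ?thesis
  proof (eventually_elim, intro impI)
    fix w :: real
    assume *: "(\<Sum>n. ennreal (f n w) * indicator {0<..1} w) \<noteq> \<infinity>" and w: "w \<in> {0<..1}"
    then have "(\<Sum>n. ennreal (f n w)) \<noteq> top" by simp
    then have "summable (\<lambda>n. f n w)"
      by (intro summable_suminf_not_top) (auto simp: f_def)
    then have "(\<lambda>n. f n w) \<longlonglongrightarrow> 0" by (rule summable_LIMSEQ_zero)
    then have "\<forall>\<^sub>F n in sequentially. f n w < 1"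
      by (rule order_tendstoD) simp
    then show "\<forall>\<^sub>F n in sequentially. t * digit_walk n w < 2 * t\<^sup>2 * real n"
      by (simp add: f_def)
  qed
qed

text \<open>
  The strong law of large numbers for the walk: the bound above with \<open>t = \<tau>\<close> and \<open>t = - \<tau>\<close>, divided by
  \<open>\<tau>\<close>, gives \<open>\<bar>digit_walk n w\<bar> < 2 * \<tau> * n\<close> eventually.  Countably many values \<open>\<tau>\<close> tending to \<open>0\<close>
  suffice, which keeps the exceptional set null.
\<close>

lemma AE_digit_walk_sublinear:
  "AE w in lborel. w \<in> {0<..1} \<longrightarrow> (\<lambda>n. digit_walk n w / real n) \<longlonglongrightarrow> 0"
proof -
  define \<tau> :: "nat \<Rightarrow> real" where "\<tau> k = inverse (real (Suc k))" for k
  have \<tau>: "\<tau> k > 0" "\<tau> k \<le> 1" for k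
    by (auto simp: \<tau>_def field_simps)
  have up: "AE w in lborel. \<forall>k. w \<in> {0<..1} \<longrightarrow>
      (\<forall>\<^sub>F n in sequentially. \<tau> k * digit_walk n w < 2 * (\<tau> k)\<^sup>2 * real n)"
    using \<tau> by (subst AE_all_countable) (intro allI AE_digit_walk_eventually_less, auto simp: less_le)
  have lo: "AE w in lborel. \<forall>k. w \<in> {0<..1} \<longrightarrow>
      (\<forall>\<^sub>F n in sequentially. - \<tau> k * digit_walk n w < 2 * (- \<tau> k)\<^sup>2 * real n)"
    using \<tau> by (subst AE_all_countable) (intro allI AE_digit_walk_eventually_less, auto simp: less_le)
  from up lo show ?thesis
  proof (eventually_elim, intro impI)
    fix w :: real
    assume up: "\<forall>k. w \<in> {0<..1} \<longrightarrow>
        (\<forall>\<^sub>F n in sequentially. \<tau> k * digit_walk n w < 2 * (\<tau> k)\<^sup>2 * real n)"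
      and lo: "\<forall>k. w \<in> {0<..1} \<longrightarrow>
        (\<forall>\<^sub>F n in sequentially. - \<tau> k * digit_walk n w < 2 * (- \<tau> k)\<^sup>2 * real n)"
      and w: "w \<in> {0<..1}"
    show "(\<lambda>n. digit_walk n w / real n) \<longlonglongrightarrow> 0"
    proof (rule tendstoI)
      fix e :: real
      assume "e > 0"
      then obtain k where k: "\<tau> k < e / 2"
        using reals_Archimedean[of "e / 2"] by (auto simp: \<tau>_def)
      have "\<forall>\<^sub>F n in sequentially. \<tau> k * digit_walk n w < 2 * (\<tau> k)\<^sup>2 * real n"
        "\<forall>\<^sub>F n in sequentially. - \<tau> k * digit_walk n w < 2 * (- \<tau> k)\<^sup>2 * real n"
        using up lo w by blast+
      then show "\<forall>\<^sub>F n in sequentially. dist (digit_walk n w / real n) 0 < e"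
        using eventually_gt_at_top[of 0]
      proof eventually_elim
        case (elim n)
        have "\<tau> k * \<bar>digit_walk n w\<bar> < \<tau> k * (2 * \<tau> k * real n)"
          using elim by (simp add: abs_if power2_eq_square algebra_simps)
        then have "\<bar>digit_walk n w\<bar> < 2 * \<tau> k * real n"
          using \<tau>[of k] by (simp only: mult_less_cancel_left_pos)
        also have "\<dots> < e * real n"
          using k elim by (intro mult_strict_right_mono) auto
        finally show ?case
          using elim by (simp add: field_simps)
      qed
    qed
  qed
qed

lemma negligible_non_balanced_digits:
  "negligible {w \<in> {0<..1}.
     \<not> (\<lambda>n. real (card (digit_set w \<inter> {1..n})) / real n) \<longlonglongrightarrow> 1/2}"
proof -
  obtain N where N: "N \<in> null_sets lborel"
    and walk: "\<And>w. w \<notin> N \<Longrightarrow> w \<in> {0<..1} \<Longrightarrow> (\<lambda>n. digit_walk n w / real n) \<longlonglongrightarrow> 0"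
    using AE_E3[OF AE_digit_walk_sublinear] by auto
  have "negligible N"
    using N by (simp add: negligible_iff_null_sets null_sets_completionI)
  moreover have "(\<lambda>n. real (card (digit_set w \<inter> {1..n})) / real n) \<longlonglongrightarrow> 1/2"
    if w: "w \<notin> N" "w \<in> {0<..1}" for w
  proof -
    have "(\<lambda>n. 1/2 * (digit_walk n w / real n) + 1/2) \<longlonglongrightarrow> 1/2 * 0 + 1/2"
      by (intro tendsto_intros walk w)
    moreover have "\<forall>\<^sub>F n in sequentially. 1/2 * (digit_walk n w / real n) + 1/2
        = real (card (digit_set w \<inter> {1..n})) / real n"
      using eventually_gt_at_top[of 0]
      by eventually_elim (simp add: digit_walk_eq_card[OF w(2)] field_simps)
    ultimately show ?thesis
      by (simp add: tendsto_cong)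
  qed
  ultimately show ?thesis
    by (elim negligible_subset) auto
qed

section \<open>Reflection of dyadic expansions and null sets\<close>

text \<open>
  Subtract the expansion of \<open>w\<close> from \<open>1 = 1/2 + 1/4 + \<dots>\<close> digit by digit.  Infinitely many zeros of
  \<open>w\<close> make the result non-terminating; at dyadic rationals the identity fails.
\<close>

lemma dyadic_digit_reflect:
  assumes w: "w \<in> {0<..1}" and inf: "infinite {i \<in> {1..}. dyadic_digit w i = 0}"
  shows "dyadic_digit (1 - w) = (\<lambda>i. if i = 0 then 0 else 1 - dyadic_digit w i)"
proof (rule dyadic_digit_unique)
  let ?d = "dyadic_digit w"
  let ?e = "\<lambda>i. if i = 0 then 0 else 1 - ?d i"
  have nd: "?d 0 = 0" "\<And>i. ?d i \<in> {0, 1}" "(\<lambda>i. real (?d i) / 2 ^ i) sums w"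
    using nonterminating_dyadic_digit[OF w] by (auto simp: nonterminating_dyadic_def)
  have d: "(\<lambda>i. real (?d (Suc i)) / 2 ^ Suc i) sums w"
    using nd(1,3) by (subst sums_Suc_iff) simp
  have e: "real (?e (Suc i)) / 2 ^ Suc i = (1/2) ^ Suc i - real (?d (Suc i)) / 2 ^ Suc i" for i
    using nd(2)[of "Suc i"] by (auto simp: power_one_over)
  have "(\<lambda>i. real (?e (Suc i)) / 2 ^ Suc i) sums (1 - w)"
    unfolding e by (intro sums_diff power_half_series d)
  then have "(\<lambda>i. real (?e i) / 2 ^ i) sums (1 - w)"
    by (subst (asm) sums_Suc_iff) simp
  moreover have "{i. ?e i = 1} = {i \<in> {1..}. ?d i = 0}"
    using nd(2) by (auto simp: Suc_le_eq)
  ultimately show "nonterminating_dyadic ?e (1 - w)"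
    using inf nd(2) by (auto simp: nonterminating_dyadic_def)
qed

text \<open>
  Digits of density one half contain zeros of density one half, hence infinitely many of them.
\<close>

lemma digit_set_reflect:
  assumes w: "w \<in> {0<..1}"
    and half: "(\<lambda>n. real (card (digit_set w \<inter> {1..n})) / real n) \<longlonglongrightarrow> 1/2"
  shows "digit_set (1 - w) = {1..} - digit_set w"
proof -
  let ?A = "digit_set w" and ?Z = "{i \<in> {1..}. dyadic_digit w i = 0}"
  have "positive_density ?Z"
  proof -
    have split: "real (card (?Z \<inter> {1..n})) = real n - real (card (?A \<inter> {1..n}))" for n
    proof -
      have "card (?Z \<inter> {1..n}) + card (?A \<inter> {1..n}) = card ((?Z \<inter> {1..n}) \<union> (?A \<inter> {1..n}))"
        by (intro card_Un_disjoint[symmetric]) auto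
      also have "(?Z \<inter> {1..n}) \<union> (?A \<inter> {1..n}) = {1..n}" by auto
      finally show ?thesis by simp
    qed
    have "(\<lambda>n. 1 - real (card (?A \<inter> {1..n})) / real n) \<longlonglongrightarrow> 1 - 1/2"
      by (intro tendsto_intros half)
    moreover have "\<forall>\<^sub>F n in sequentially. 1 - real (card (?A \<inter> {1..n})) / real n
        = real (card (?Z \<inter> {1..n})) / real n"
      using eventually_gt_at_top[of 0] by eventually_elim (simp only: split diff_divide_distrib, simp)
    ultimately have "(\<lambda>n. real (card (?Z \<inter> {1..n})) / real n) \<longlonglongrightarrow> 1/2"
      by (simp add: tendsto_cong)
    then show ?thesis
      unfolding positive_density_def by (intro exI[of _ "1/2"]) simp
  qed
  then have "infinite ?Z" by (rule positive_density_imp_infinite)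
  moreover have "dyadic_digit w i \<in> {0, 1}" for i
    using nonterminating_dyadic_digit[OF w] by (simp add: nonterminating_dyadic_def)
  ultimately show ?thesis
    using dyadic_digit_reflect[OF w] by (auto simp: Suc_le_eq)
qed

lemma negligible_reflect:
  fixes N :: "real set"
  assumes "negligible N"
  shows "negligible {w. 1 - w \<in> N}"
proof -
  have "negligible ((\<lambda>w. 1 - w) ` N)"
    by (rule negligible_differentiable_image_negligible[OF _ assms]) (auto intro!: derivative_intros)
  moreover have "{w. 1 - w \<in> N} = (\<lambda>w. 1 - w) ` N"
  proof (intro set_eqI iffI)
    fix w
    assume "w \<in> {w. 1 - w \<in> N}"
    then show "w \<in> (\<lambda>w. 1 - w) ` N"
      by (intro image_eqI[of _ _ "1 - w"]) auto
  qed auto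
  ultimately show ?thesis by simp
qed

lemma full_measure_iff_negligible_complement:
  assumes "G \<subseteq> {0<..1::real}"
  shows "G \<in> sets (lebesgue_on {0<..1}) \<and> emeasure (lebesgue_on {0<..1}) G = 1
    \<longleftrightarrow> negligible ({0<..1} - G)"
proof -
  have S: "{0<..1::real} \<in> sets lebesgue" "emeasure lebesgue {0<..1::real} = 1" by simp_all
  have sets: "G \<in> sets (lebesgue_on {0<..1}) \<longleftrightarrow> G \<in> sets lebesgue"
    using assms S by (simp add: sets_restrict_space_iff)
  have em: "emeasure (lebesgue_on {0<..1}) G = emeasure lebesgue G"
    using assms S by (simp add: emeasure_restrict_space)
  have G: "G = {0<..1} - ({0<..1} - G)"
    using assms by blast
  show ?thesis
    unfolding sets em negligible_iff_null_sets
  proof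
    assume *: "G \<in> sets lebesgue \<and> emeasure lebesgue G = 1"
    then have "emeasure lebesgue ({0<..1} - G) = 0"
      using assms S by (subst emeasure_Diff) auto
    then show "{0<..1} - G \<in> null_sets lebesgue"
      using * S by (intro null_setsI) auto
  next
    assume N: "{0<..1} - G \<in> null_sets lebesgue"
    have "G \<in> sets lebesgue"
      by (subst G) (intro sets.Diff S null_setsD2[OF N])
    moreover have "emeasure lebesgue G = 1"
      using emeasure_Diff_null_set[OF N S(1)] S(2) G by simp
    ultimately show "G \<in> sets lebesgue \<and> emeasure lebesgue G = 1" ..
  qed
qed

section \<open>Convergence of almost all subsequences\<close>

theorem theorem3p5:
  fixes I :: "nat set set"
    and X :: "'a topology"
    and x :: "nat \<Rightarrow> 'a"
    and l :: 'a
  assumes "invariant_ideal I"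
    and "\<And>n. n \<in> {1..} \<Longrightarrow> x n \<in> topspace X"
    and "l \<in> topspace X"
  shows "ideal_converges X I x l \<longleftrightarrow>
    {\<omega> \<in> {0<..1::real}. ideal_converges X I (subseq_at x \<omega>) l} \<in> sets (lebesgue_on {0<..1}) \<and>
    emeasure (lebesgue_on {0<..1}) {\<omega> \<in> {0<..1::real}. ideal_converges X I (subseq_at x \<omega>) l} = 1"
proof -
  define G where "G = {\<omega> \<in> {0<..1::real}. ideal_converges X I (subseq_at x \<omega>) l}"
  define N where "N = {w \<in> {0<..1}.
    \<not> (\<lambda>n. real (card (digit_set w \<inter> {1..n})) / real n) \<longlonglongrightarrow> 1/2}"
  define nbhd where
    "nbhd U \<longleftrightarrow> U \<subseteq> topspace X \<and> (\<exists>V. openin X V \<and> l \<in> V \<and> V \<subseteq> U)" for U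
  have I_subset: "B \<in> I" if "A \<in> I" "B \<subseteq> A" for A B
    using assms(1) that unfolding invariant_ideal_def ideal_on_pos_def by blast
  have I_Un: "A \<union> B \<in> I" if "A \<in> I" "B \<in> I" for A B
    using assms(1) that unfolding invariant_ideal_def ideal_on_pos_def by blast
  have G_iff: "w \<in> G \<longleftrightarrow> (\<forall>U. nbhd U \<longrightarrow> {n \<in> digit_set w. x n \<notin> U} \<in> I)"
    if w: "w \<in> {0<..1} - N" for w
  proof -
    have "positive_density (digit_set w)"
      unfolding positive_density_def using w by (intro exI[of _ "1/2"]) (auto simp: N_def)
    then show ?thesis
      using ideal_converges_subsequence_iff[OF assms(1), of "digit_set w" X x l] w
      unfolding G_def nbhd_def subseq_at_def[abs_def] by auto
  qed
  have "ideal_converges X I x l \<longleftrightarrow> negligible ({0<..1} - G)"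
  proof
    assume x: "ideal_converges X I x l"
    have "w \<in> G" if w: "w \<in> {0<..1} - N" for w
      unfolding G_iff[OF w]
    proof (intro allI impI)
      fix U assume "nbhd U"
      then have "{n \<in> {1..}. x n \<notin> U} \<in> I"
        using x by (simp add: ideal_converges_def nbhd_def)
      then show "{n \<in> digit_set w. x n \<notin> U} \<in> I"
        by (rule I_subset) blast
    qed
    then have "{0<..1} - G \<subseteq> N" by blast
    then show "negligible ({0<..1} - G)"
      using negligible_non_balanced_digits negligible_subset unfolding N_def by blast
  next
    assume "negligible ({0<..1} - G)"
    then have M: "negligible (({0<..1} - G) \<union> N)"
      using negligible_non_balanced_digits unfolding N_def by (rule negligible_Un)
    \<comment> \<open>A null set and its reflection cannot cover the unit interval, so some \<open>w\<close> is good
      together with \<open>1 - w\<close>.\<close>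
    have "\<not> negligible {0<..<1::real}"
      by (rule open_not_negligible) auto
    then have "\<not> {0<..<1} \<subseteq>
        (({0<..1} - G) \<union> N) \<union> {w. 1 - w \<in> ({0<..1} - G) \<union> N}"
      using negligible_subset negligible_Un[OF M negligible_reflect[OF M]] by blast
    then obtain w where "w \<in> {0<..<1}" "w \<notin> ({0<..1} - G) \<union> N" "1 - w \<notin> ({0<..1} - G) \<union> N"
      by blast
    then have w: "w \<in> {0<..1} - N" "w \<in> G" and w': "1 - w \<in> {0<..1} - N" "1 - w \<in> G"
      by auto
    show "ideal_converges X I x l"
      unfolding ideal_converges_def nbhd_def[symmetric]
    proof (intro allI impI)
      fix U assume U: "nbhd U"
      have "digit_set (1 - w) = {1..} - digit_set w"
        using w by (intro digit_set_reflect) (auto simp: N_def)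
      then have "{n \<in> {1..}. x n \<notin> U}
          = {n \<in> digit_set w. x n \<notin> U} \<union> {n \<in> digit_set (1 - w). x n \<notin> U}"
        by blast
      then show "{n \<in> {1..}. x n \<notin> U} \<in> I"
        using I_Un G_iff[OF w(1)] G_iff[OF w'(1)] w(2) w'(2) U by presburger
    qed
  qed
  moreover have "G \<subseteq> {0<..1}" by (auto simp: G_def)
  ultimately show ?thesis
    using full_measure_iff_negligible_complement[of G] unfolding G_def by presburger
qed

end
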